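(* Let $\mathcal G^0=(\mathcal V,\mathcal E^0)$ be an undirected graph with $N$ vertices, $p\in[0,1]$, and let $\hat G$ be the decomposable jump linear system with nominal communication graph $\mathcal G^0$, agent matrices $A^d,A^c\in\mathbb R^{n_x\times n_x}$, and Bernoulli packet loss with transmission probability $p$ (as defined in the context). Let $\lambda_1,\dots,\lambda_N$ be the eigenvalues of $L^0=L(\mathcal G^0)$. If there exists a symmetric $Q\in\mathbb R^{n_x\times n_x}$ with $Q\succ0$ such that $$\big(A^d+p\lambda_iA^c\big)^TQ\big(A^d+p\lambda_iA^c\big)-Q+2p(1-p)\lambda_iA^{cT}QA^c\prec0$$ for all $i\in\{1,\dots,N\}$, then $\hat G$ is mean-square stable.
   Context: Notation: $\otimes$ is the Kronecker product; $M\succ 0$ ($M\prec0$) means that the symmetric matrix $M$ is positive (negative) definite; $A^{cT}=(A^c)^T$. Graphs: a graph $\mathcal G=(\mathcal V,\mathcal E)$ has vertex set $\mathcal V=\{v_1,\dots,v_N\}$ and edge set $\mathcal E\subset\mathcal V\times\mathcal V$ without self-loops; $e_{ij}=(v_j,v_i)$ is the edge from $v_j$ to $v_i$; $\mathcal G$ is undirected if $e_{ij}\in\mathcal E\Leftrightarrow e_{ji}\in\mathcal E$. The in-neighbourhood is $\mathcal N_i^-=\{v_j: e_{ij}\in\mathcal E\}$, with $d_i^-=|\mathcal N_i^-|$. The Laplacian $L(\mathcal G)=[l_{ij}]$ has $l_{ij}=-1$ if $i\ne j$ and $v_j\in\mathcal N_i^-$, $l_{ij}=0$ if $i\neq j$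 and $v_j\notin\mathcal N_i^-$, and $l_{ii}=d_i^-$. Packet loss model: to each edge $e_{ij}\in\mathcal E^0$ is attached a stationary process $\alpha_{ij}(k)\in\{0,1\}$, $k\ge0$ ($1$: packet transmitted, $0$: packet lost), independent in time, with $\Pr(\alpha_{ij}(k)=1)=p$ and $\Pr(\alpha_{ij}(k)=0)=1-p$. The variables $\alpha_{ij}(k)$ and $\alpha_{rs}(k')$ are independent whenever $k\ne k'$ or [$(r,s)\neq(i,j)$ and $(r,s)\ne(j,i)$] (so losses on opposing links $e_{ij}$, $e_{ji}$ may be correlated, and need not be equal). The mode $\sigma(k)\in\mathcal K=\{1,\dots,2^{|\mathcal E^0|}\}$ encodes bijectively the values $(\alpha_{ij}(k))_{e_{ij}\in\mathcal E^0}$; $\mathcal G_i=(\mathcal V,\mathcal E_i)$, where $\mathcal E_i\subseteq\mathcal E^0$ is the set of edges active ($\alpha=1$) in mode $i$, and $L_i=L(\mathcal G_i)$. Thus $\sigma(k)$ are independent over time with $\Pr(\sigma(k)=i)=t_i$, the probability of the corresponding loss pattern; when an initial distribution $\sigma_0$ is prescribed, it is the distribution of $\sigma(0)$, and $\Pr(\sigma(k)=i)=t_i$ independently for $k\ge1$. Decomposable jump linear system $\hat G$: $$x(k+1)=(I_N\otimes A^d+L_{\sigma(k)}\otimes A^c)x(k)+(I_N\otimes B^d+L_{\sigma(k)}\otimes B^c)w(k),$$ $$z(k)=(I_N\otimes C^d+L_{\sigma(k)}\otimes C^c)x(k)+(I_N\otimes D^d+L_{\sigma(k)}\otimes D^c)w(k),$$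 with $x(k)\in\mathbb R^{Nn_x}$, $w(k)\in\mathbb R^{Nn_w}$, $z(k)\in\mathbb R^{Nn_z}$, $x(0)=x_0$ and real matrices of compatible dimensions. Mean-square stability: with $w\equiv0$, $\lim_{k\to\infty}\mathbb E[\|x(k)\|]=0$ and $\lim_{k\to\infty}\mathbb E[\|x(k)x^T(k)\|]=0$ for all initial conditions $x_0$ and all initial distributions $\sigma_0$. *)

theory Defs
  imports "HOL-Probability.Probability"
begin

definition kron :: "real^'n^'m \<Rightarrow> real^'q^'p \<Rightarrow> real^('n \<times> 'q)^('m \<times> 'p)" where
  "kron A B = (\<chi> r c. A $ fst r $ fst c * B $ snd r $ snd c)"

definition outer :: "real^'n \<Rightarrow> real^'n^'n" where
  "outer x = (\<chi> i j. x $ i * x $ j)"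

definition pos_def :: "real^'n^'n \<Rightarrow> bool" where
  "pos_def M \<longleftrightarrow> transpose M = M \<and> (\<forall>x. x \<noteq> 0 \<longrightarrow> x \<bullet> (M *v x) > 0)"

definition neg_def :: "real^'n^'n \<Rightarrow> bool" where
  "neg_def M \<longleftrightarrow> transpose M = M \<and> (\<forall>x. x \<noteq> 0 \<longrightarrow> x \<bullet> (M *v x) < 0)"

text \<open>The eigenvalues of a square matrix, listed with algebraic multiplicity (in any order) as
  \<open>l 1, \<dots>, l N\<close>: the characteristic polynomial splits into the factors \<open>s - l i\<close>. Only matrices with
  real spectrum have such a list; every Laplacian of an undirected graph is symmetric, hence does.\<close>

definition eigenvalues :: "real^'n^'n \<Rightarrow> (nat \<Rightarrow> real) \<Rightarrow> bool" where
  "eigenvalues A l \<longleftrightarrow> (\<forall>s. det (mat s - A) = (\<Prod>i = 1..CARD('n). s - l i))"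

text \<open>The vertex set of a graph is the finite type \<open>'v\<close>; the pair \<open>(j, i)\<close> is the edge from \<open>j\<close> to \<open>i\<close>.
  An undirected graph without self-loops is a relation that is \<open>sym\<close> and \<open>irrefl\<close>.\<close>

definition in_neighbours :: "('v \<times> 'v) set \<Rightarrow> 'v \<Rightarrow> 'v set" where
  "in_neighbours E i = {j. (j, i) \<in> E}"

definition laplacian :: "('v::finite \<times> 'v) set \<Rightarrow> real^'v^'v" where
  "laplacian E = (\<chi> i j. if i = j then real (card (in_neighbours E i))
                          else if j \<in> in_neighbours E i then -1 else 0)"

definition active :: "('v \<times> 'v) set \<Rightarrow> ('v \<times> 'v \<Rightarrow> nat \<Rightarrow> 'w \<Rightarrow> bool) \<Rightarrow> nat \<Rightarrow> 'w \<Rightarrow> ('v \<times> 'v) set" where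
  "active E \<alpha> k \<omega> = {e \<in> E. \<alpha> e k \<omega>}"

text \<open>\<open>\<alpha> e k \<omega>\<close> holds iff the packet on edge \<open>e\<close> at time \<open>k\<close> is transmitted. The loss patterns are
  mutually independent over time and identically distributed. Within one time step, independence is
  required for pairs of edges only, and not at all for opposing edges, whose losses may be
  arbitrarily correlated.\<close>

definition packet_loss_process ::
    "'w measure \<Rightarrow> ('v \<times> 'v) set \<Rightarrow> real \<Rightarrow> ('v \<times> 'v \<Rightarrow> nat \<Rightarrow> 'w \<Rightarrow> bool) \<Rightarrow> bool" where
  "packet_loss_process \<Omega> E p \<alpha> \<longleftrightarrow>
     prob_space \<Omega> \<and>
     (\<forall>e\<in>E. \<forall>k. \<alpha> e k \<in> measurable \<Omega> (count_space UNIV)) \<and>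
     (\<forall>e\<in>E. \<forall>k. measure \<Omega> {\<omega> \<in> space \<Omega>. \<alpha> e k \<omega>} = p) \<and>
     prob_space.indep_vars \<Omega> (\<lambda>_. count_space UNIV) (active E \<alpha>) UNIV \<and>
     (\<forall>k. distr \<Omega> (count_space UNIV) (active E \<alpha> k) = distr \<Omega> (count_space UNIV) (active E \<alpha> 0)) \<and>
     (\<forall>k. \<forall>e\<in>E. \<forall>e'\<in>E. e' \<noteq> e \<and> e' \<noteq> prod.swap e \<longrightarrow>
        prob_space.indep_var \<Omega> (count_space UNIV) (\<alpha> e k) (count_space UNIV) (\<alpha> e' k))"

definition modes :: "('v \<times> 'v) set \<Rightarrow> nat set" where
  "modes E = {1..2 ^ card E}"

text \<open>\<open>Em i\<close> is the set of edges active in mode \<open>i\<close>.\<close>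

definition mode_encoding :: "('v \<times> 'v) set \<Rightarrow> (nat \<Rightarrow> ('v \<times> 'v) set) \<Rightarrow> bool" where
  "mode_encoding E Em \<longleftrightarrow> bij_betw Em (modes E) (Pow E)"

definition mode_process ::
    "('v \<times> 'v) set \<Rightarrow> (nat \<Rightarrow> ('v \<times> 'v) set) \<Rightarrow> ('v \<times> 'v \<Rightarrow> nat \<Rightarrow> 'w \<Rightarrow> bool) \<Rightarrow> nat \<Rightarrow> 'w \<Rightarrow> nat" where
  "mode_process E Em \<alpha> k \<omega> = the_inv_into (modes E) Em (active E \<alpha> k \<omega>)"

record ('x::finite, 'u::finite, 'z::finite) agent =
  Ad :: "real^'x^'x"
  Ac :: "real^'x^'x"
  Bd :: "real^'u^'x"
  Bc :: "real^'u^'x"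
  Cd :: "real^'x^'z"
  Cc :: "real^'x^'z"
  Dd :: "real^'u^'z"
  Dc :: "real^'u^'z"

definition decomposable :: "real^'v^'v \<Rightarrow> real^'n^'m \<Rightarrow> real^'n^'m \<Rightarrow> real^('v \<times> 'n)^('v \<times> 'm)" where
  "decomposable L Md Mc = kron (mat 1) Md + kron L Mc"

text \<open>State and output along one mode path \<open>s\<close>, with \<open>Lm i\<close> the Laplacian of mode \<open>i\<close>.\<close>

primrec state ::
    "('x::finite, 'u::finite, 'z::finite) agent \<Rightarrow> (nat \<Rightarrow> real^'v^'v) \<Rightarrow> (nat \<Rightarrow> nat)
      \<Rightarrow> (nat \<Rightarrow> real^('v \<times> 'u)) \<Rightarrow> real^('v \<times> 'x) \<Rightarrow> nat \<Rightarrow> real^('v \<times> 'x)" where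
  "state G Lm s w x0 0 = x0"
| "state G Lm s w x0 (Suc k) =
     decomposable (Lm (s k)) (Ad G) (Ac G) *v state G Lm s w x0 k
     + decomposable (Lm (s k)) (Bd G) (Bc G) *v w k"

definition output_signal ::
    "('x::finite, 'u::finite, 'z::finite) agent \<Rightarrow> (nat \<Rightarrow> real^'v^'v) \<Rightarrow> (nat \<Rightarrow> nat)
      \<Rightarrow> (nat \<Rightarrow> real^('v \<times> 'u)) \<Rightarrow> real^('v \<times> 'x) \<Rightarrow> nat \<Rightarrow> real^('v \<times> 'z)" where
  "output_signal G Lm s w x0 k =
     decomposable (Lm (s k)) (Cd G) (Cc G) *v state G Lm s w x0 k
     + decomposable (Lm (s k)) (Dd G) (Dc G) *v w k"

text \<open>A mode process \<open>\<sigma>\<close> that is independent over time is given the initial distribution \<open>\<sigma>0\<close> by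
  replacing \<open>\<sigma>(0)\<close> with an independent draw from \<open>\<sigma>0\<close>; the modes at times \<open>k \<ge> 1\<close> are unchanged.\<close>

definition with_initial_mode :: "(nat \<Rightarrow> 'w \<Rightarrow> nat) \<Rightarrow> nat \<times> 'w \<Rightarrow> nat \<Rightarrow> nat" where
  "with_initial_mode \<sigma> \<eta> k = (if k = 0 then fst \<eta> else \<sigma> k (snd \<eta>))"

text \<open>The matrix norm below is the Frobenius norm. The integrands take almost surely only finitely
  many values when the mode set \<open>K\<close> is finite, so the expectations exist.\<close>

definition mean_square_stable ::
    "('x::finite, 'u::finite, 'z::finite) agent \<Rightarrow> (nat \<Rightarrow> real^'v^'v) \<Rightarrow> nat set
      \<Rightarrow> 'w measure \<Rightarrow> (nat \<Rightarrow> 'w \<Rightarrow> nat) \<Rightarrow> bool" where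
  "mean_square_stable G Lm K \<Omega> \<sigma> \<longleftrightarrow>
     (\<forall>x0. \<forall>\<sigma>0 :: nat pmf. set_pmf \<sigma>0 \<subseteq> K \<longrightarrow>
        (let P = measure_pmf \<sigma>0 \<Otimes>\<^sub>M \<Omega>;
             x = (\<lambda>k \<eta>. state G Lm (with_initial_mode \<sigma> \<eta>) (\<lambda>_. 0) x0 k)
         in (\<lambda>k. \<integral>\<eta>. norm (x k \<eta>) \<partial>P) \<longlonglongrightarrow> 0 \<and>
            (\<lambda>k. \<integral>\<eta>. norm (outer (x k \<eta>)) \<partial>P) \<longlonglongrightarrow> 0))"

end

theory Submission
  imports Defs
begin

text \<open>
  The Lyapunov function is \<open>V x = (\<Sum>i. x\<^sub>i \<bullet> Q x\<^sub>i)\<close>. Row \<open>i\<close> of the random Laplacian involves only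
  edges with head \<open>i\<close>; no two of these are opposing, so their losses are uncorrelated. Hence the
  conditional expectation of \<open>V\<close> after one step is \<open>V\<close> of the mean step plus
  \<open>p (1 - p) (\<Sum>(j, i)\<in>E. d\<^sub>i\<^sub>j \<bullet> Q d\<^sub>i\<^sub>j)\<close> with \<open>d\<^sub>i\<^sub>j = A\<^sup>c (x\<^sub>i - x\<^sub>j)\<close>, and for a symmetric graph that sum is
  twice the Dirichlet form of \<open>L\<^sup>0\<close>. In an orthonormal eigenbasis of \<open>L\<^sup>0\<close> everything decouples into the
  matrix inequalities of the hypothesis, so \<open>V\<close> strictly decreases in expectation, by compactness at a
  uniform rate \<open>\<rho> < 1\<close>. Independence over time makes \<open>E [V (x k)]\<close> decay geometrically from time 1 on,
  whatever the distribution of the initial mode.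
\<close>

subsection \<open>Spectral theorem for symmetric real matrices\<close>

text \<open>A maximiser of \<open>x \<bullet> f x\<close> on the compact unit sphere of
  \<open>S\<close> is an eigenvector: invariance of \<open>S\<close> keeps the gradient of
  \<open>x \<bullet> f x - \<mu> * (x \<bullet> x)\<close> at \<open>u\<close> inside
  \<open>S\<close>, where it has to vanish.\<close>

lemma self_adjoint_eigenvector_exists:
  fixes f :: "'a::euclidean_space \<Rightarrow> 'a"
  assumes lin: "linear f" and sa: "\<And>x y. f x \<bullet> y = x \<bullet> f y"
    and S: "subspace S" and inv: "f ` S \<subseteq> S" and ne: "S \<noteq> {0}"
  obtains u \<mu> where "u \<in> S" "norm u = 1" "f u = \<mu> *\<^sub>R u"
proof -
  let ?K = "S \<inter> sphere 0 1"
  obtain v where v: "v \<in> S" "v \<noteq> 0"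
    using ne subspace_0[OF S] by blast
  have "v /\<^sub>R norm v \<in> ?K"
    using v S by (simp add: subspace_scale)
  moreover have "compact ?K"
    using closed_subspace[OF S] by (simp add: closed_Int_compact)
  moreover have "continuous_on ?K (\<lambda>x. x \<bullet> f x)"
    by (intro continuous_intros linear_continuous_on linear_conv_bounded_linear[THEN iffD1] lin)
  ultimately have "\<exists>u\<in>?K. \<forall>y\<in>?K. y \<bullet> f y \<le> u \<bullet> f u"
    by (intro continuous_attains_sup) blast+
  then obtain u where u: "u \<in> ?K" and max: "\<And>y. y \<in> ?K \<Longrightarrow> y \<bullet> f y \<le> u \<bullet> f u"
    by blast
  define \<mu> where "\<mu> = u \<bullet> f u"
  have uS: "u \<in> S" and nu: "norm u = 1" and uu: "u \<bullet> u = 1"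
    using u by (auto simp: dot_square_norm)
  have bound: "x \<bullet> f x \<le> \<mu> * (x \<bullet> x)" if "x \<in> S" for x
  proof (cases "x = 0")
    case False
    define y where "y = x /\<^sub>R norm x"
    have "x = norm x *\<^sub>R y" using False by (simp add: y_def)
    then have "x \<bullet> f x = (norm x)\<^sup>2 * (y \<bullet> f y)"
      by (metis inner_scaleR_left inner_scaleR_right lin linear_scale mult.assoc power2_eq_square)
    also have "y \<in> ?K" using that False S by (simp add: y_def subspace_scale)
    then have "(norm x)\<^sup>2 * (y \<bullet> f y) \<le> (norm x)\<^sup>2 * \<mu>"
      unfolding \<mu>_def by (intro mult_left_mono max) auto
    finally show ?thesis by (simp add: power2_norm_eq_inner mult.commute)
  qed (simp add: linear_0[OF lin])
  \<comment> \<open>\<open>w\<close> is half the gradient at \<open>u\<close> of \<open>x \<bullet> f x - \<mu> * (x \<bullet> x)\<close>, whose maximum on \<open>S\<close> is attained at \<open>u\<close>.\<close>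
  define w where "w = f u - \<mu> *\<^sub>R u"
  have wS: "w \<in> S" unfolding w_def using inv uS S by (auto intro: subspace_diff subspace_scale)
  have wu: "w \<bullet> f u - \<mu> * (w \<bullet> u) = w \<bullet> w" by (simp add: w_def algebra_simps inner_simps)
  define c where "c = w \<bullet> f w - \<mu> * (w \<bullet> w)"
  \<comment> \<open>This is \<open>bound\<close> at \<open>u + t *\<^sub>R w\<close>; equality at
    \<open>u\<close> cancels the constant terms and leaves a linear term proportional to
    \<open>w \<bullet> w\<close>.\<close>
  have first_order: "2 * t * (w \<bullet> w) + t\<^sup>2 * c \<le> 0" for t
  proof -
    have "(u + t *\<^sub>R w) \<bullet> f (u + t *\<^sub>R w) \<le> \<mu> * ((u + t *\<^sub>R w) \<bullet> (u + t *\<^sub>R w))"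
      using uS wS S by (intro bound) (simp add: subspace_add subspace_scale)
    moreover have "u \<bullet> f w = w \<bullet> f u" by (metis sa inner_commute)
    ultimately have "u \<bullet> f u + 2 * t * (w \<bullet> f u) + t\<^sup>2 * (w \<bullet> f w)
        \<le> \<mu> * (u \<bullet> u + 2 * t * (w \<bullet> u) + t\<^sup>2 * (w \<bullet> w))"
      by (simp add: linear_add[OF lin] linear_scale[OF lin] inner_left_distrib inner_right_distrib
            inner_commute[of u w] power2_eq_square algebra_simps)
    then have "\<mu> + 2 * t * (w \<bullet> f u) + t\<^sup>2 * (w \<bullet> f w)
        \<le> \<mu> * (1 + 2 * t * (w \<bullet> u) + t\<^sup>2 * (w \<bullet> w))"
      by (simp only: uu \<mu>_def)
    moreover have "2 * t * (w \<bullet> w) + t\<^sup>2 * c = \<mu> + 2 * t * (w \<bullet> f u) + t\<^sup>2 * (w \<bullet> f w)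
        - \<mu> * (1 + 2 * t * (w \<bullet> u) + t\<^sup>2 * (w \<bullet> w))"
      unfolding wu[symmetric] c_def by (simp only: algebra_simps)
    ultimately show ?thesis by linarith
  qed
  have "w \<bullet> w = 0"
  proof (rule ccontr)
    assume "w \<bullet> w \<noteq> 0"
    then have pos: "w \<bullet> w > 0" by simp
    \<comment> \<open>Small enough that the quadratic term is at most half the linear one in
      absolute value, so the left side of \<open>first_order\<close> would be positive.\<close>
    define t where "t = (w \<bullet> w) / (\<bar>c\<bar> + 1)"
    have t: "t > 0" using pos by (simp add: t_def add_nonneg_pos)
    have "t * (2 * (w \<bullet> w) + t * c) \<le> 0"
      using first_order[of t] by (simp add: algebra_simps power2_eq_square)
    then have "2 * (w \<bullet> w) + t * c \<le> 0" using t by (simp add: mult_le_0_iff)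
    moreover have "t * \<bar>c\<bar> \<le> w \<bullet> w"
      using pos by (simp add: t_def field_simps)
    moreover have "- (t * \<bar>c\<bar>) \<le> t * c" using t
      by (metis abs_ge_minus_self abs_mult abs_of_pos minus_le_iff)
    ultimately show False using pos by linarith
  qed
  then have "f u = \<mu> *\<^sub>R u" by (simp add: w_def)
  then show thesis using that uS nu by blast
qed

text \<open>Induction on the dimension: split off one unit eigenvector \<open>u\<close>;
  self-adjointness makes the orthogonal complement of \<open>u\<close> in \<open>S\<close>
  invariant. For unit vectors in \<open>S\<close> the expansion formula already encodes
  orthonormality.\<close>

lemma self_adjoint_eigenbasis_subspace:
  fixes f :: "'a::euclidean_space \<Rightarrow> 'a"
  assumes lin: "linear f" and sa: "\<And>x y. f x \<bullet> y = x \<bullet> f y"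
    and "subspace S" and "f ` S \<subseteq> S"
  shows "\<exists>B. finite B \<and> B \<subseteq> S \<and> (\<forall>u\<in>B. norm u = 1 \<and> (\<exists>\<mu>. f u = \<mu> *\<^sub>R u)) \<and>
    (\<forall>x\<in>S. x = (\<Sum>u\<in>B. (u \<bullet> x) *\<^sub>R u))"
  using assms(3,4)
proof (induction "dim S" arbitrary: S rule: less_induct)
  case less
  show ?case
  proof (cases "S = {0}")
    case True
    then show ?thesis by (intro exI[of _ "{}"]) auto
  next
    case False
    obtain u \<mu> where u: "u \<in> S" "norm u = 1" "f u = \<mu> *\<^sub>R u"
      using self_adjoint_eigenvector_exists[OF lin sa less.prems False] by metis
    have uu: "u \<bullet> u = 1" using u(2) by (simp add: dot_square_norm)
    define T where "T = {x \<in> S. u \<bullet> x = 0}"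
    have T: "subspace T"
      unfolding T_def using less.prems(1) by (auto simp: subspace_def inner_simps)
    have "u \<notin> T" using uu by (simp add: T_def)
    moreover have "T \<subseteq> S" by (auto simp: T_def)
    ultimately have "T \<subset> S" using u(1) by blast
    then have "dim T < dim S"
      using dim_psubset[of T S] T less.prems(1) by (metis span_eq_iff)
    moreover have "f ` T \<subseteq> T"
    proof
      fix y assume "y \<in> f ` T"
      then obtain x where x: "x \<in> T" "y = f x" by blast
      have "u \<bullet> f x = f u \<bullet> x" by (simp add: sa)
      then have "u \<bullet> f x = 0" using x u(3) by (simp add: T_def)
      then show "y \<in> T" using x less.prems(2) by (auto simp: T_def)
    qed
    ultimately obtain B where B: "finite B" "B \<subseteq> T"
        "\<forall>v\<in>B. norm v = 1 \<and> (\<exists>\<mu>. f v = \<mu> *\<^sub>R v)"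
        and ex: "\<forall>x\<in>T. x = (\<Sum>v\<in>B. (v \<bullet> x) *\<^sub>R v)"
      using less.hyps[OF _ T] by metis
    have uB: "u \<notin> B" using B(2) \<open>u \<notin> T\<close> by blast
    have "x = (\<Sum>v\<in>insert u B. (v \<bullet> x) *\<^sub>R v)" if x: "x \<in> S" for x
    proof -
      \<comment> \<open>Removing the component along \<open>u\<close> lands in \<open>T\<close>, and
        it leaves the coefficients against \<open>B\<close> unchanged because \<open>B\<close> is
        orthogonal to \<open>u\<close>.\<close>
      let ?y = "x - (u \<bullet> x) *\<^sub>R u"
      have "?y \<in> T"
        using x u(1) less.prems(1) uu
        by (auto simp: T_def inner_simps intro: subspace_diff subspace_scale)
      then have "?y = (\<Sum>v\<in>B. (v \<bullet> ?y) *\<^sub>R v)" using ex by blast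
      also have "\<dots> = (\<Sum>v\<in>B. (v \<bullet> x) *\<^sub>R v)"
      proof (rule sum.cong)
        fix v assume "v \<in> B"
        then have "v \<bullet> u = 0" using B(2) by (auto simp: T_def inner_commute)
        then show "(v \<bullet> ?y) *\<^sub>R v = (v \<bullet> x) *\<^sub>R v" by (simp add: inner_simps)
      qed simp
      finally show ?thesis using B(1) uB by (simp add: algebra_simps)
    qed
    then show ?thesis
      using B u \<open>T \<subseteq> S\<close> by (intro exI[of _ "insert u B"]) auto
  qed
qed

text \<open>The last property is the completeness relation, with the sum of the projections
  \<open>u u^T\<close> equal to the identity; it comes from expanding the coordinate vectors and is
  the form in which Parseval's identity uses the basis.\<close>

lemma symmetric_matrix_eigenbasis:
  fixes A :: "real^'n^'n"
  assumes "transpose A = A"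
  obtains B where "finite B" "\<And>u. u \<in> B \<Longrightarrow> u \<noteq> 0"
    "\<And>u. u \<in> B \<Longrightarrow> \<exists>\<mu>. A *v u = \<mu> *\<^sub>R u"
    "\<And>i j. (\<Sum>u\<in>B. u $ i * u $ j) = of_bool (i = j)"
proof -
  have "(A *v x) \<bullet> y = x \<bullet> (A *v y)" for x y
    by (metis assms dot_lmul_matrix vector_transpose_matrix)
  then obtain B where B: "finite B" "\<forall>u\<in>B. norm u = 1 \<and> (\<exists>\<mu>. A *v u = \<mu> *\<^sub>R u)"
    and ex: "\<forall>x. x = (\<Sum>u\<in>B. (u \<bullet> x) *\<^sub>R u)"
    using self_adjoint_eigenbasis_subspace[of "(*v) A" UNIV] by auto
  have "(\<Sum>u\<in>B. u $ i * u $ j) = of_bool (i = j)" for i j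
  proof -
    have "axis j (1::real) $ i = (\<Sum>u\<in>B. (u \<bullet> axis j 1) *\<^sub>R u) $ i"
      using ex by metis
    then have "(\<Sum>u\<in>B. u $ i * u $ j) = axis j 1 $ i" by (simp add: inner_axis mult.commute)
    then show ?thesis by (simp add: axis_def)
  qed
  then show thesis using that[of B] B by fastforce
qed

text \<open>An eigenvector makes \<open>mat \<mu> - A\<close> singular, so one factor of the
  characteristic polynomial vanishes at \<open>\<mu>\<close>. This ties the eigenbasis to the listed
  eigenvalues.\<close>

lemma eigenvalue_in_eigenvalues:
  fixes A :: "real^'n^'n"
  assumes "eigenvalues A l" "A *v u = \<mu> *\<^sub>R u" "u \<noteq> 0"
  obtains i where "i \<in> {1..CARD('n)}" "\<mu> = l i"
proof -
  have "mat \<mu> *v u = \<mu> *\<^sub>R u"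
    by (simp add: vec_eq_iff matrix_vector_mult_def mat_def if_distrib[of "\<lambda>c. c * _"] cong: if_cong)
  then have "(mat \<mu> - A) *v u = 0"
    using assms(2) by (simp add: matrix_vector_mult_diff_rdistrib)
  then have "\<not> invertible (mat \<mu> - A)"
    using assms(3) invertible_left_inverse matrix_left_invertible_ker by blast
  then have "det (mat \<mu> - A) = 0" by (simp add: invertible_det_nz)
  then show thesis using assms(1) that by (auto simp: eigenvalues_def)
qed

subsection \<open>Block vectors, Laplacians and modal coordinates\<close>

definition block :: "real^('v::finite \<times> 'x::finite) \<Rightarrow> 'v \<Rightarrow> real^'x" where
  "block x i = (\<chi> a. x $ (i, a))"

lemma block_add: "block (x + y) i = block x i + block y i"
  by (simp add: block_def vec_eq_iff)

lemma block_scaleR: "block (c *\<^sub>R x) i = c *\<^sub>R block x i"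
  by (simp add: block_def vec_eq_iff)

lemma block_eq_0_iff: "(\<forall>i. block x i = 0) \<longleftrightarrow> x = 0"
  by (auto simp: block_def vec_eq_iff)

lemma block_kron:
  "block (kron A M *v x) i = M *v (\<Sum>j\<in>UNIV. A $ i $ j *\<^sub>R block x j)"
proof -
  have "block (kron A M *v x) i $ a = (M *v (\<Sum>j\<in>UNIV. A $ i $ j *\<^sub>R block x j)) $ a" for a
  proof -
    have "block (kron A M *v x) i $ a = (\<Sum>j\<in>UNIV. \<Sum>b\<in>UNIV. A $ i $ j * M $ a $ b * x $ (j, b))"
      by (simp add: block_def kron_def matrix_vector_mult_def sum.cartesian_product case_prod_beta
          flip: UNIV_Times_UNIV)
    also have "\<dots> = (\<Sum>b\<in>UNIV. M $ a $ b * (\<Sum>j\<in>UNIV. A $ i $ j * x $ (j, b)))"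
      by (subst sum.swap) (simp add: sum_distrib_left mult_ac)
    finally show ?thesis by (simp add: block_def matrix_vector_mult_def)
  qed
  then show ?thesis by (simp add: vec_eq_iff)
qed

lemma block_decomposable:
  "block (decomposable L Md Mc *v x) i
     = Md *v block x i + Mc *v (\<Sum>j\<in>UNIV. L $ i $ j *\<^sub>R block x j)"
proof -
  have "(\<Sum>j\<in>UNIV. (mat 1 :: real^'b^'b) $ i $ j *\<^sub>R block x j) = (\<Sum>j\<in>UNIV. if i = j then block x j else 0)"
    by (intro sum.cong) (auto simp: mat_def)
  then show ?thesis
    by (simp add: decomposable_def matrix_vector_mult_add_rdistrib block_add block_kron)
qed

text \<open>The degree counts the edges into \<open>i\<close>, so each of them contributes one
  \<open>X i\<close> and one \<open>- X j\<close>. A self-loop would enter the degree but give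
  \<open>X i - X i = 0\<close> on the right. Symmetry of \<open>D\<close> is not assumed, so the
  formula also covers a random set of active edges.\<close>

lemma laplacian_sum:
  fixes X :: "'v::finite \<Rightarrow> 'b::real_vector"
  assumes "irrefl D"
  shows "(\<Sum>j\<in>UNIV. laplacian D $ i $ j *\<^sub>R X j) = (\<Sum>j\<in>UNIV. of_bool ((j, i) \<in> D) *\<^sub>R (X i - X j))"
proof -
  have "laplacian D $ i $ j *\<^sub>R X j
      = (if j = i then (\<Sum>l\<in>UNIV. of_bool ((l, i) \<in> D)) *\<^sub>R X i else 0) - of_bool ((j, i) \<in> D) *\<^sub>R X j" for j
    using assms by (auto simp: laplacian_def in_neighbours_def irrefl_def of_bool_def sum.If_cases Int_def)
  then show ?thesis
    unfolding scaleR_diff_right sum_subtractf scaleR_sum_left[symmetric]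
    by (simp add: sum_subtractf)
qed

lemma transpose_laplacian:
  assumes "sym E"
  shows "transpose (laplacian E) = laplacian E"
  using assms by (auto simp: laplacian_def transpose_def vec_eq_iff in_neighbours_def sym_def)

lemma bounded_bilinear_matrix_form:
  "bounded_bilinear (\<lambda>u v. u \<bullet> ((Q :: real^'n^'m) *v v))"
  by (rule bounded_bilinear.comp[OF bounded_bilinear_inner bounded_linear_ident])
     (rule matrix_vector_mul_bounded_linear)

text \<open>Component of the block vector \<open>X\<close> along the eigenvector \<open>u\<close> of the graph Laplacian.\<close>

definition modal :: "real^'v::finite \<Rightarrow> ('v \<Rightarrow> 'b) \<Rightarrow> 'b::real_vector" where
  "modal u X = (\<Sum>i\<in>UNIV. u $ i *\<^sub>R X i)"

lemma modal_linear:
  assumes "linear f"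
  shows "modal u (\<lambda>i. f (X i)) = f (modal u X)"
  by (simp add: modal_def linear_sum[OF assms] linear_scale[OF assms])

lemma modal_add: "modal u (\<lambda>i. X i + Y i) = modal u X + modal u Y"
  by (simp add: modal_def scaleR_add_right sum.distrib)

text \<open>By symmetry \<open>u\<close> is also a left eigenvector, so exchanging the two sums
  turns the action of \<open>A\<close> into the scalar \<open>\<mu>\<close>.\<close>

lemma modal_eigenvector:
  assumes "transpose A = A" "A *v u = \<mu> *\<^sub>R u"
  shows "modal u (\<lambda>i. \<Sum>j\<in>UNIV. A $ i $ j *\<^sub>R X j) = \<mu> *\<^sub>R modal u X"
proof -
  have "(\<Sum>i\<in>UNIV. u $ i * A $ i $ j) = \<mu> * u $ j" for j
  proof -
    have "(transpose A *v u) $ j = \<mu> * u $ j" using assms by simp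
    then show ?thesis by (simp add: transpose_def matrix_vector_mult_def mult.commute)
  qed
  moreover have "modal u (\<lambda>i. \<Sum>j\<in>UNIV. A $ i $ j *\<^sub>R X j)
      = (\<Sum>j\<in>UNIV. (\<Sum>i\<in>UNIV. u $ i * A $ i $ j) *\<^sub>R X j)"
    unfolding modal_def scaleR_sum_right scaleR_sum_left by (subst sum.swap) simp
  ultimately show ?thesis by (simp add: modal_def scaleR_sum_right)
qed

text \<open>After expanding both arguments and moving the sum over \<open>B\<close> innermost, the
  completeness relation collapses the double sum to its diagonal.\<close>

lemma (in bounded_bilinear) modal_parseval:
  assumes "finite B" "\<And>i j. (\<Sum>u\<in>B. u $ i * u $ j) = of_bool (i = j)"
  shows "(\<Sum>i\<in>UNIV. prod (X i) (Y i)) = (\<Sum>u\<in>B. prod (modal u X) (modal u Y))"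
proof -
  have "(\<Sum>u\<in>B. prod (modal u X) (modal u Y))
      = (\<Sum>u\<in>B. \<Sum>j\<in>UNIV. \<Sum>i\<in>UNIV. (u $ i * u $ j) *\<^sub>R prod (X i) (Y j))"
    by (simp add: modal_def sum_left sum_right scaleR_left scaleR_right scaleR_sum_right mult.commute)
  also have "\<dots> = (\<Sum>j\<in>UNIV. \<Sum>i\<in>UNIV. (\<Sum>u\<in>B. u $ i * u $ j) *\<^sub>R prod (X i) (Y j))"
    unfolding scaleR_sum_left
    by (subst sum.swap, intro sum.cong refl, subst sum.swap, rule refl)
  also have "\<dots> = (\<Sum>j\<in>UNIV. \<Sum>i\<in>UNIV. if i = j then prod (X i) (Y j) else 0)"
    by (intro sum.cong) (auto simp: assms)
  finally show ?thesis by simp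
qed

text \<open>Split the left argument of \<open>prod (X i - X j) (X i - X j)\<close>. Reversing every
  edge turns the part with \<open>X j\<close> into minus the part with \<open>X i\<close>, so the
  two halves agree and each is the Laplacian form.\<close>

lemma laplacian_dirichlet_form:
  fixes prod :: "'a::real_normed_vector \<Rightarrow> 'a \<Rightarrow> 'b::real_normed_vector" and X :: "'v::finite \<Rightarrow> 'a"
  assumes "bounded_bilinear prod" and "irrefl E" "sym E"
  shows "(\<Sum>i\<in>UNIV. \<Sum>j\<in>UNIV. of_bool ((j, i) \<in> E) *\<^sub>R prod (X i - X j) (X i - X j))
    = 2 *\<^sub>R (\<Sum>i\<in>UNIV. prod (X i) (\<Sum>j\<in>UNIV. laplacian E $ i $ j *\<^sub>R X j))"
proof -
  interpret bounded_bilinear prod by fact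
  let ?S = "\<Sum>i\<in>UNIV. \<Sum>j\<in>UNIV. of_bool ((j, i) \<in> E) *\<^sub>R prod (X i) (X i - X j)"
  have E: "(i, j) \<in> E \<longleftrightarrow> (j, i) \<in> E" for i j using assms(3) by (auto simp: sym_def)
  have "(\<Sum>i\<in>UNIV. \<Sum>j\<in>UNIV. of_bool ((j, i) \<in> E) *\<^sub>R prod (X j) (X i - X j))
      = (\<Sum>j\<in>UNIV. \<Sum>i\<in>UNIV. of_bool ((j, i) \<in> E) *\<^sub>R prod (X j) (X i - X j))"
    by (rule sum.swap)
  also have "\<dots> = - ?S"
    unfolding sum_negf[symmetric] by (intro sum.cong refl) (subst E, simp add: diff_right)
  finally have "(\<Sum>i\<in>UNIV. \<Sum>j\<in>UNIV. of_bool ((j, i) \<in> E) *\<^sub>R prod (X i - X j) (X i - X j)) = ?S - - ?S"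
    by (simp add: diff_left scaleR_diff_right sum_subtractf)
  also have "\<dots> = 2 *\<^sub>R ?S" by (simp add: scaleR_2)
  finally show ?thesis
    by (simp add: laplacian_sum[OF assms(2)] sum_right scaleR_right)
qed

text \<open>Because of this identity, the second stability limit is convergence of the mean squared
  norm.\<close>

lemma norm_outer: "norm (outer x) = (norm x)\<^sup>2"
proof -
  have "norm (outer x) = sqrt (\<Sum>i\<in>UNIV. \<Sum>j\<in>UNIV. (x $ i)\<^sup>2 * (x $ j)\<^sup>2)"
    by (simp add: outer_def norm_vec_def L2_set_def sum_nonneg power_mult_distrib)
  also have "\<dots> = sqrt ((\<Sum>i\<in>UNIV. (x $ i)\<^sup>2)\<^sup>2)"
    by (simp add: power2_eq_square[of "sum _ _"] sum_product)
  finally show ?thesis by (simp add: norm_vec_def L2_set_def sum_nonneg)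
qed

subsection \<open>Lyapunov inequality\<close>

text \<open>The ratio \<open>q / r\<close> is constant along rays, so its maximum over the compact
  unit sphere is global. This yields both the uniform contraction rate and the comparison of the
  norm with the Lyapunov function.\<close>

lemma quadratic_ratio_attains_sup:
  fixes q r :: "'a::euclidean_space \<Rightarrow> real"
  assumes "continuous_on UNIV q" "continuous_on UNIV r"
    and q: "\<And>c x. q (c *\<^sub>R x) = c\<^sup>2 * q x" and r: "\<And>c x. r (c *\<^sub>R x) = c\<^sup>2 * r x"
    and pos: "\<And>x. x \<noteq> 0 \<Longrightarrow> 0 < r x"
  shows "\<exists>u. u \<noteq> 0 \<and> (\<forall>x. q x \<le> q u / r u * r x)"
proof -
  let ?K = "sphere (0::'a) 1"
  have "continuous_on ?K (\<lambda>x. q x / r x)"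
  proof (intro continuous_on_divide)
    show "\<forall>x\<in>?K. r x \<noteq> 0" using pos by (metis less_irrefl mem_sphere_0 norm_zero zero_neq_one)
  qed (use assms(1,2) continuous_on_subset in blast)+
  then have "\<exists>u\<in>?K. \<forall>y\<in>?K. q y / r y \<le> q u / r u"
    by (intro continuous_attains_sup) auto
  then obtain u where u: "u \<in> ?K" and max: "\<And>y. y \<in> ?K \<Longrightarrow> q y / r y \<le> q u / r u"
    by blast
  have "q x \<le> q u / r u * r x" for x
  proof (cases "x = 0")
    case True
    then show ?thesis using q[of 0 x] r[of 0 x] by simp
  next
    case False
    define y where "y = x /\<^sub>R norm x"
    have x: "x = norm x *\<^sub>R y" and y: "y \<in> ?K" using False by (simp_all add: y_def)
    have "0 < r y" using y by (intro pos) auto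
    then have "(norm x)\<^sup>2 * q y \<le> (norm x)\<^sup>2 * (q u / r u * r y)"
      using max[OF y] by (intro mult_left_mono) (auto simp: divide_le_eq)
    then show ?thesis by (subst (1 2) x) (simp add: q r mult_ac)
  qed
  moreover have "u \<noteq> 0" using u by auto
  ultimately show ?thesis by (intro exI[of _ u] conjI allI)
qed

text \<open>The quadratic form of \<open>kron (mat 1) Q\<close>, which serves as the Lyapunov
  function.\<close>

definition block_form :: "real^'x^'x \<Rightarrow> real^('v::finite \<times> 'x::finite) \<Rightarrow> real" where
  "block_form Q x = (\<Sum>i\<in>UNIV. block x i \<bullet> (Q *v block x i))"

text \<open>Closed form of the expectation of \<open>block_form Q\<close> after one random step from \<open>x\<close>.\<close>

definition expected_block_form ::
    "('v::finite \<times> 'v) set \<Rightarrow> real \<Rightarrow> real^'x^'x \<Rightarrow> real^'x^'x \<Rightarrow> real^'x^'x \<Rightarrow> real^('v \<times> 'x::finite) \<Rightarrow> real"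
  where "expected_block_form E p Md Mc Q x =
    block_form Q (decomposable (p *\<^sub>R laplacian E) Md Mc *v x) +
    p * (1 - p) * (\<Sum>i\<in>UNIV. \<Sum>j\<in>UNIV. of_bool ((j, i) \<in> E) *
      ((Mc *v (block x i - block x j)) \<bullet> (Q *v (Mc *v (block x i - block x j)))))"

lemma continuous_on_block: "continuous_on S (\<lambda>x. block x i)"
  by (intro linear_continuous_on linear_conv_bounded_linear[THEN iffD1] linearI)
     (simp_all add: block_add block_scaleR)

lemma continuous_on_matrix_vector_mult:
  fixes M :: "real^'n^'m"
  shows "continuous_on S f \<Longrightarrow> continuous_on S (\<lambda>x. M *v f x)"
  by (rule bounded_linear.continuous_on[OF matrix_vector_mul_bounded_linear])

lemma continuous_on_block_form: "continuous_on S (block_form Q)"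
  unfolding block_form_def
  by (intro continuous_intros continuous_on_block continuous_on_matrix_vector_mult)

lemma continuous_on_expected_block_form: "continuous_on S (expected_block_form E p Md Mc Q)"
  unfolding expected_block_form_def
  by (intro continuous_intros continuous_on_block continuous_on_matrix_vector_mult
      continuous_on_compose2[OF continuous_on_block_form]) auto

lemma block_form_scaleR: "block_form Q (c *\<^sub>R x) = c\<^sup>2 * block_form Q x"
  by (simp add: block_form_def block_scaleR matrix_vector_mult_scaleR sum_distrib_left
      power2_eq_square mult_ac)

lemma expected_block_form_scaleR:
  "expected_block_form E p Md Mc Q (c *\<^sub>R x) = c\<^sup>2 * expected_block_form E p Md Mc Q x"
  by (simp add: expected_block_form_def block_form_scaleR block_scaleR matrix_vector_mult_scaleR
      flip: scaleR_diff_right)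
     (simp add: sum_distrib_left power2_eq_square mult_ac distrib_left)

lemma block_form_pos:
  assumes "pos_def Q" "x \<noteq> 0"
  shows "0 < block_form Q x"
proof -
  have nonneg: "0 \<le> y \<bullet> (Q *v y)" for y
    using assms(1) unfolding pos_def_def by (cases "y = 0") (auto intro: less_imp_le)
  obtain i where "block x i \<noteq> 0" using assms(2) block_eq_0_iff by blast
  then have "0 < block x i \<bullet> (Q *v block x i)" using assms(1) by (simp add: pos_def_def)
  then show ?thesis unfolding block_form_def by (intro sum_pos2[of _ i]) (auto simp: nonneg)
qed

text \<open>In modal coordinates the difference of the two sides is a sum over
  \<open>u \<in> B\<close> of the assumed negative definite forms, evaluated at the components
  \<open>y u\<close>.\<close>

lemma expected_block_form_less:
  fixes E :: "('v::finite \<times> 'v) set" and x :: "real^('v \<times> 'x::finite)"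
  assumes E: "irrefl E" "sym E" and "eigenvalues (laplacian E) l"
    and neg: "\<And>i. i \<in> {1..CARD('v)} \<Longrightarrow>
      neg_def (transpose (Md + (p * l i) *\<^sub>R Mc) ** Q ** (Md + (p * l i) *\<^sub>R Mc)
        - Q + (2 * p * (1 - p) * l i) *\<^sub>R (transpose Mc ** Q ** Mc))"
    and "x \<noteq> 0"
  shows "expected_block_form E p Md Mc Q x < block_form Q x"
proof -
  let ?L = "laplacian E"
  let ?q = "\<lambda>y z. y \<bullet> (Q *v z)"
  obtain B where B: "finite B" "\<And>u. u \<in> B \<Longrightarrow> u \<noteq> 0"
    "\<And>u. u \<in> B \<Longrightarrow> \<exists>\<mu>. ?L *v u = \<mu> *\<^sub>R u"
    "\<And>i j. (\<Sum>u\<in>B. u $ i * u $ j) = of_bool (i = j)"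
    using symmetric_matrix_eigenbasis[OF transpose_laplacian[OF E(2)]] by metis
  obtain \<mu> where \<mu>: "\<And>u. u \<in> B \<Longrightarrow> ?L *v u = \<mu> u *\<^sub>R u" using B(3) by metis
  define y where "y = (\<lambda>u. modal u (block x))"
  have parseval: "(\<Sum>i\<in>UNIV. ?q (X i) (Y i)) = (\<Sum>u\<in>B. ?q (modal u X) (modal u Y))" for X Y
    by (rule bounded_bilinear.modal_parseval[OF bounded_bilinear_matrix_form B(1,4)])
  have form: "block_form Q x = (\<Sum>u\<in>B. ?q (y u) (y u))"
    unfolding block_form_def y_def by (rule parseval)
  \<comment> \<open>Along \<open>u\<close> the Laplacian acts as the scalar \<open>\<mu> u\<close>,
    so the mean step multiplies the component \<open>y u\<close> by
    \<open>Md + (p * \<mu> u) *\<^sub>R Mc\<close>.\<close>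
  have mean: "block_form Q (decomposable (p *\<^sub>R ?L) Md Mc *v x)
      = (\<Sum>u\<in>B. ?q ((Md + (p * \<mu> u) *\<^sub>R Mc) *v y u) ((Md + (p * \<mu> u) *\<^sub>R Mc) *v y u))"
  proof -
    have "modal u (block (decomposable (p *\<^sub>R ?L) Md Mc *v x)) = (Md + (p * \<mu> u) *\<^sub>R Mc) *v y u"
      if "u \<in> B" for u
    proof -
      have "block (decomposable (p *\<^sub>R ?L) Md Mc *v x)
          = (\<lambda>i. Md *v block x i + (p *\<^sub>R Mc) *v (\<Sum>j\<in>UNIV. ?L $ i $ j *\<^sub>R block x j))"
        by (rule ext) (simp add: block_decomposable scaleR_matrix_vector_assoc
            matrix_vector_mult_scaleR flip: scaleR_scaleR scaleR_sum_right)
      moreover have "modal u (\<lambda>i. p *\<^sub>R (Mc *v Z i)) = p *\<^sub>R (Mc *v modal u Z)" for Z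
        by (intro modal_linear linear_compose_scale_right matrix_vector_mul_linear)
      ultimately show ?thesis
        by (simp add: modal_add modal_linear[OF matrix_vector_mul_linear] y_def
            modal_eigenvector[OF transpose_laplacian[OF E(2)] \<mu>[OF that]]
            matrix_vector_mult_add_rdistrib matrix_vector_mult_scaleR
            flip: scaleR_matrix_vector_assoc)
    qed
    then show ?thesis unfolding block_form_def by (subst parseval) simp
  qed
  \<comment> \<open>The variance term is twice a Dirichlet form, here of the blocks
    \<open>Mc *v block x i\<close>; this is the origin of the factor 2 in the matrix
    inequality.\<close>
  have var: "(\<Sum>i\<in>UNIV. \<Sum>j\<in>UNIV. of_bool ((j, i) \<in> E) *
        ?q (Mc *v (block x i - block x j)) (Mc *v (block x i - block x j)))
      = 2 * (\<Sum>u\<in>B. \<mu> u * ?q (Mc *v y u) (Mc *v y u))"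
  proof -
    let ?X = "\<lambda>i. Mc *v block x i"
    have "(\<Sum>i\<in>UNIV. \<Sum>j\<in>UNIV. of_bool ((j, i) \<in> E) * ?q (?X i - ?X j) (?X i - ?X j))
        = 2 * (\<Sum>i\<in>UNIV. ?q (?X i) (\<Sum>j\<in>UNIV. ?L $ i $ j *\<^sub>R ?X j))"
      using laplacian_dirichlet_form[OF bounded_bilinear_matrix_form[of Q] E, of ?X] by simp
    also have "\<dots> = 2 * (\<Sum>u\<in>B. ?q (Mc *v y u) (\<mu> u *\<^sub>R (Mc *v y u)))"
      by (subst parseval) (simp add: y_def modal_linear[OF matrix_vector_mul_linear]
          modal_eigenvector[OF transpose_laplacian[OF E(2)] \<mu>])
    finally show ?thesis by (simp add: matrix_vector_mult_diff_distrib matrix_vector_mult_scaleR)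
  qed
  define \<Phi> where "\<Phi> = (\<lambda>u. ?q ((Md + (p * \<mu> u) *\<^sub>R Mc) *v y u) ((Md + (p * \<mu> u) *\<^sub>R Mc) *v y u)
      - ?q (y u) (y u) + 2 * p * (1 - p) * \<mu> u * ?q (Mc *v y u) (Mc *v y u))"
  have diff: "expected_block_form E p Md Mc Q x - block_form Q x = sum \<Phi> B"
    unfolding expected_block_form_def var mean form \<Phi>_def
    unfolding sum.distrib sum_subtractf
    by (simp add: sum_distrib_left) (intro sum.cong refl, simp add: algebra_simps)
  have \<Phi>: "\<Phi> u < 0" if u: "u \<in> B" "y u \<noteq> 0" for u
  proof -
    obtain i where i: "i \<in> {1..CARD('v)}" "\<mu> u = l i"
      using eigenvalue_in_eigenvalues[OF assms(3) \<mu>[OF u(1)] B(2)[OF u(1)]] by metis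
    have congruence: "v \<bullet> ((transpose M ** Q ** M) *v v) = ?q (M *v v) (M *v v)" for M v
    proof -
      have "v \<bullet> ((transpose M ** Q ** M) *v v) = v \<bullet> (transpose M *v (Q *v (M *v v)))"
        by (simp only: matrix_vector_mul_assoc matrix_mul_assoc)
      then show ?thesis by (simp only: dot_lmul_matrix[symmetric] vector_transpose_matrix)
    qed
    have "y u \<bullet> ((transpose (Md + (p * l i) *\<^sub>R Mc) ** Q ** (Md + (p * l i) *\<^sub>R Mc)
        - Q + (2 * p * (1 - p) * l i) *\<^sub>R (transpose Mc ** Q ** Mc)) *v y u) < 0"
      using neg[OF i(1)] u(2) unfolding neg_def_def by blast
    then show ?thesis
      by (simp add: \<Phi>_def i(2) matrix_vector_mult_add_rdistrib matrix_vector_mult_diff_rdistrib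
          inner_add_right inner_diff_right congruence del: transpose_matrix_vector
          flip: scaleR_matrix_vector_assoc)
  qed
  \<comment> \<open>Parseval for the plain inner product: if all components vanished, so would
    \<open>x\<close>.\<close>
  have "\<exists>u\<in>B. y u \<noteq> 0"
  proof (rule ccontr)
    assume "\<not> ?thesis"
    then have "(\<Sum>i\<in>UNIV. block x i \<bullet> block x i) = 0"
      using bounded_bilinear.modal_parseval[OF bounded_bilinear_inner B(1,4), of "block x" "block x"]
      by (simp add: y_def)
    then have "\<forall>i. block x i = 0" by (simp add: sum_nonneg_eq_0_iff)
    then show False using \<open>x \<noteq> 0\<close> block_eq_0_iff by blast
  qed
  then obtain u where u: "u \<in> B" "y u \<noteq> 0" by blast
  have "\<Phi> v \<le> 0" if "v \<in> B" for v
  proof (cases "y v = 0")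
    case False then show ?thesis using \<Phi> that by (simp add: less_imp_le)
  qed (simp add: \<Phi>_def)
  then have "sum \<Phi> B < sum (\<lambda>_. 0) B"
    using \<Phi>[OF u] u(1) B(1) by (intro sum_strict_mono_ex1) auto
  then show ?thesis using diff by simp
qed

text \<open>The largest ratio of the two forms is attained at some nonzero \<open>u\<close>, where
  the strict inequality applies; attainment makes the rate uniformly less than 1.\<close>

lemma expected_block_form_contraction:
  fixes E :: "('v::finite \<times> 'v) set" and Q :: "real^'x::finite^'x"
  assumes "irrefl E" "sym E" "eigenvalues (laplacian E) l" "pos_def Q"
    and "\<And>i. i \<in> {1..CARD('v)} \<Longrightarrow>
      neg_def (transpose (Md + (p * l i) *\<^sub>R Mc) ** Q ** (Md + (p * l i) *\<^sub>R Mc)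
        - Q + (2 * p * (1 - p) * l i) *\<^sub>R (transpose Mc ** Q ** Mc))"
  obtains \<rho> where "0 \<le> \<rho>" "\<rho> < 1"
    "\<And>x :: real^('v \<times> 'x). expected_block_form E p Md Mc Q x \<le> \<rho> * block_form Q x"
proof -
  have "\<exists>u :: real^('v \<times> 'x). u \<noteq> 0 \<and> (\<forall>x. expected_block_form E p Md Mc Q x
      \<le> expected_block_form E p Md Mc Q u / block_form Q u * block_form Q x)"
    by (rule quadratic_ratio_attains_sup[OF continuous_on_expected_block_form continuous_on_block_form
        expected_block_form_scaleR block_form_scaleR block_form_pos[OF \<open>pos_def Q\<close>]])
  then obtain u :: "real^('v \<times> 'x)" where u: "u \<noteq> 0"
    "\<And>x. expected_block_form E p Md Mc Q x \<le> expected_block_form E p Md Mc Q u / block_form Q u * block_form Q x"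
    by blast
  let ?r = "expected_block_form E p Md Mc Q u / block_form Q u"
  have nonneg: "0 \<le> block_form Q x" for x :: "real^('v \<times> 'x)"
    using block_form_pos[OF \<open>pos_def Q\<close>, of x] block_form_scaleR[of Q 0 x]
    by (cases "x = 0") (auto intro: less_imp_le)
  show thesis
  proof
    \<comment> \<open>Taking the maximum with 0 secures \<open>0 \<le> \<rho>\<close> without
      examining the sign of the ratio.\<close>
    show "max 0 ?r < 1"
      using expected_block_form_less[OF assms(1-3,5) u(1)] block_form_pos[OF \<open>pos_def Q\<close> u(1)] by simp
    show "expected_block_form E p Md Mc Q x \<le> max 0 ?r * block_form Q x" for x
      using u(2)[of x] nonneg[of x] by (meson max.cobounded2 mult_right_mono order_trans)
  qed simp
qed

text \<open>Transfers decay of the Lyapunov function to decay of the squared norm.\<close>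

lemma norm_square_le_block_form:
  fixes Q :: "real^'x::finite^'x"
  assumes "pos_def Q"
  obtains c where "0 \<le> c" "\<And>x :: real^('v::finite \<times> 'x). (norm x)\<^sup>2 \<le> c * block_form Q x"
proof -
  have cont: "continuous_on UNIV (\<lambda>x :: real^('v \<times> 'x). (norm x)\<^sup>2)"
    by (intro continuous_intros)
  have hom: "(norm (c *\<^sub>R x))\<^sup>2 = c\<^sup>2 * (norm x)\<^sup>2" for c and x :: "real^('v \<times> 'x)"
    by (simp add: power_mult_distrib)
  have "\<exists>u :: real^('v \<times> 'x). u \<noteq> 0 \<and>
      (\<forall>x :: real^('v \<times> 'x). (norm x)\<^sup>2 \<le> (norm u)\<^sup>2 / block_form Q u * block_form Q x)"
    by (rule quadratic_ratio_attains_sup[OF cont continuous_on_block_form hom block_form_scaleR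
        block_form_pos[OF assms]])
  then obtain u :: "real^('v \<times> 'x)" where u: "u \<noteq> 0"
    and bound: "\<forall>x :: real^('v \<times> 'x). (norm x)\<^sup>2 \<le> (norm u)\<^sup>2 / block_form Q u * block_form Q x"
    by (elim exE conjE)
  have "0 \<le> (norm u)\<^sup>2 / block_form Q u"
    using block_form_pos[OF assms u] by simp
  then show thesis by (rule that) (rule bound[rule_format])
qed

subsection \<open>Expectation of one step\<close>

text \<open>The expression is a quadratic polynomial in the coefficients \<open>c j\<close>, so only
  their first and second moments enter. Uncorrelated coefficients with variances \<open>v j\<close>
  add just a diagonal term to the value at the means.\<close>

lemma (in prob_space) expectation_bilinear_random_sum:
  fixes b :: "'b::real_normed_vector \<Rightarrow> 'b \<Rightarrow> real" and c :: "'v::finite \<Rightarrow> 'a \<Rightarrow> real"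
  assumes "bounded_bilinear b"
    and int: "\<And>j. integrable M (c j)" "\<And>j l. integrable M (\<lambda>\<omega>. c j \<omega> * c l \<omega>)"
    and mean: "\<And>j. expectation (c j) = m j"
    and cov: "\<And>j l. expectation (\<lambda>\<omega>. c j \<omega> * c l \<omega>) = m j * m l + of_bool (j = l) * v j"
  shows "integrable M (\<lambda>\<omega>. b (g + (\<Sum>j\<in>UNIV. c j \<omega> *\<^sub>R h j)) (g + (\<Sum>j\<in>UNIV. c j \<omega> *\<^sub>R h j)))" (is ?integrable)
    and "expectation (\<lambda>\<omega>. b (g + (\<Sum>j\<in>UNIV. c j \<omega> *\<^sub>R h j)) (g + (\<Sum>j\<in>UNIV. c j \<omega> *\<^sub>R h j)))
    = b (g + (\<Sum>j\<in>UNIV. m j *\<^sub>R h j)) (g + (\<Sum>j\<in>UNIV. m j *\<^sub>R h j)) + (\<Sum>j\<in>UNIV. v j * b (h j) (h j))" (is ?expectation)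
proof -
  interpret b: bounded_bilinear b by fact
  have expand: "b (g + (\<Sum>j\<in>UNIV. a j *\<^sub>R h j)) (g + (\<Sum>j\<in>UNIV. a j *\<^sub>R h j))
      = b g g + (\<Sum>j\<in>UNIV. a j * (b g (h j) + b (h j) g)) + (\<Sum>j\<in>UNIV. \<Sum>l\<in>UNIV. a j * a l * b (h l) (h j))" for a
    by (simp add: b.add_left b.add_right b.sum_left b.sum_right b.scaleR_left b.scaleR_right
        sum.distrib distrib_left sum_distrib_left mult_ac)
  show ?integrable unfolding expand using int by simp
  have "expectation (\<lambda>\<omega>. b (g + (\<Sum>j\<in>UNIV. c j \<omega> *\<^sub>R h j)) (g + (\<Sum>j\<in>UNIV. c j \<omega> *\<^sub>R h j)))
      = b g g + (\<Sum>j\<in>UNIV. m j * (b g (h j) + b (h j) g))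
        + (\<Sum>j\<in>UNIV. \<Sum>l\<in>UNIV. (m j * m l + of_bool (j = l) * v j) * b (h l) (h j))"
    unfolding expand using int
    by (simp add: Bochner_Integration.integral_add Bochner_Integration.integral_sum mean cov prob_space)
  also have "\<dots> = b g g + (\<Sum>j\<in>UNIV. m j * (b g (h j) + b (h j) g))
        + (\<Sum>j\<in>UNIV. \<Sum>l\<in>UNIV. m j * m l * b (h l) (h j)) + (\<Sum>j\<in>UNIV. v j * b (h j) (h j))"
  proof -
    have "(\<Sum>l\<in>UNIV. of_bool (j = l) * v j * b (h l) (h j)) = v j * b (h j) (h j)" for j
      by (simp add: of_bool_def if_distrib[of "\<lambda>a. a * _"] cong: if_cong)
    then show ?thesis by (simp add: distrib_right sum.distrib)
  qed
  finally show ?expectation by (simp add: expand)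
qed

text \<open>The form is a sum over agents, and agent \<open>i\<close> sees only edges with head
  \<open>i\<close>. Hence no joint law across different rows enters, and pairwise independence
  within a row gives the covariances.\<close>

lemma expectation_block_form:
  fixes E :: "('v::finite \<times> 'v) set" and \<alpha> :: "'v \<times> 'v \<Rightarrow> nat \<Rightarrow> 'w \<Rightarrow> bool"
  assumes loss: "packet_loss_process \<Omega> E p \<alpha>" and "irrefl E"
  shows "(\<integral>\<omega>. block_form Q (decomposable (laplacian (active E \<alpha> k \<omega>)) Md Mc *v x) \<partial>\<Omega>)
    = expected_block_form E p Md Mc Q x"
proof -
  interpret prob_space \<Omega> using loss by (simp add: packet_loss_process_def)
  have meas[measurable]: "\<alpha> e k \<in> measurable \<Omega> (count_space UNIV)" if "e \<in> E" for e
    using loss that by (simp add: packet_loss_process_def)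
  define c where "c = (\<lambda>i j \<omega>. of_bool ((j, i) \<in> active E \<alpha> k \<omega>) :: real)"
  define m where "m = (\<lambda>i j. p * of_bool ((j, i) \<in> E))"
  define v where "v = (\<lambda>i j. p * (1 - p) * of_bool ((j, i) \<in> E))"
  let ?b = "\<lambda>y z. y \<bullet> (Q *v z)"
  let ?g = "\<lambda>i. Md *v block x i"
  let ?h = "\<lambda>i j. Mc *v (block x i - block x j)"
  have c_alt: "c i j = (\<lambda>\<omega>. of_bool (\<alpha> (j, i) k \<omega>))" if "(j, i) \<in> E" for i j
    using that by (auto simp: c_def active_def)
  have c_0: "c i j = (\<lambda>\<omega>. 0)" if "(j, i) \<notin> E" for i j
    using that by (auto simp: c_def active_def)
  have [measurable]: "c i j \<in> borel_measurable \<Omega>" for i j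
  proof (cases "(j, i) \<in> E")
    case True
    have "(\<lambda>\<omega>. of_bool (\<alpha> (j, i) k \<omega>) :: real) \<in> borel_measurable \<Omega>"
      using meas[OF True] by measurable
    then show ?thesis by (simp add: c_alt[OF True])
  qed (simp add: c_0)
  have int: "integrable \<Omega> (c i j)" for i j
    by (rule integrable_const_bound[where B=1]) (simp add: c_def, measurable)
  have int2: "integrable \<Omega> (\<lambda>\<omega>. c i j \<omega> * c i l \<omega>)" for i j l
    by (rule integrable_const_bound[where B=1]) (simp add: c_def, measurable)
  have mean: "expectation (c i j) = m i j" for i j
  proof (cases "(j, i) \<in> E")
    case True
    have "expectation (c i j) = expectation (indicator {\<omega> \<in> space \<Omega>. \<alpha> (j, i) k \<omega>})"
      by (intro Bochner_Integration.integral_cong) (auto simp: c_alt[OF True] indicator_def)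
    also have "\<dots> = prob {\<omega> \<in> space \<Omega>. \<alpha> (j, i) k \<omega>}"
      by (simp add: Int_absorb2 subset_eq)
    also have "\<dots> = p" using loss True by (simp add: packet_loss_process_def)
    finally show ?thesis using True by (simp add: m_def)
  qed (simp add: c_0 m_def)
  have cov: "expectation (\<lambda>\<omega>. c i j \<omega> * c i l \<omega>) = m i j * m i l + of_bool (j = l) * v i j" for i j l
  proof (cases "j = l")
    case True
    \<comment> \<open>An indicator is idempotent, so its second moment is \<open>p\<close>, which
      equals \<open>p * p + p * (1 - p)\<close>.\<close>
    have "(\<lambda>\<omega>. c i j \<omega> * c i j \<omega>) = c i j" by (auto simp: c_def)
    then show ?thesis using True mean[of i j]
      by (cases "(j, i) \<in> E") (simp_all add: m_def v_def algebra_simps)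
  next
    case False
    show ?thesis
    proof (cases "(j, i) \<in> E \<and> (l, i) \<in> E")
      case True
      \<comment> \<open>Two opposing edges with the same head would be self-loops.\<close>
      have "(j, i) \<noteq> prod.swap (l, i)" using True \<open>irrefl E\<close> by (auto simp: irrefl_def)
      then have "(l, i) \<noteq> (j, i) \<and> (l, i) \<noteq> prod.swap (j, i)" using False by auto
      then have "indep_var (count_space UNIV) (\<alpha> (j, i) k) (count_space UNIV) (\<alpha> (l, i) k)"
        using loss True unfolding packet_loss_process_def by blast
      then have "indep_var borel ((of_bool :: bool \<Rightarrow> real) \<circ> \<alpha> (j, i) k) borel (of_bool \<circ> \<alpha> (l, i) k)"
        by (rule indep_var_compose) auto
      then have "indep_var borel (c i j) borel (c i l)"
        using True by (simp add: c_alt comp_def)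
      then show ?thesis
        using indep_var_lebesgue_integral[OF _ int int] False by (simp add: mean)
    qed (use False in \<open>auto simp: c_0 m_def\<close>)
  qed
  have step: "block (decomposable (laplacian (active E \<alpha> k \<omega>)) Md Mc *v x) i
      = ?g i + (\<Sum>j\<in>UNIV. c i j \<omega> *\<^sub>R ?h i j)" for \<omega> i
  proof -
    have "irrefl (active E \<alpha> k \<omega>)" using \<open>irrefl E\<close> by (auto simp: irrefl_def active_def)
    then show ?thesis
      by (simp add: block_decomposable laplacian_sum c_def linear_sum[OF matrix_vector_mul_linear]
          matrix_vector_mult_scaleR)
  qed
  \<comment> \<open>The mean step has the shape of \<open>step\<close> with each random coefficient
    replaced by its mean.\<close>
  have mean_step: "block (decomposable (p *\<^sub>R laplacian E) Md Mc *v x) i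
      = ?g i + (\<Sum>j\<in>UNIV. m i j *\<^sub>R ?h i j)" for i
    using laplacian_sum[OF \<open>irrefl E\<close>, of i "block x"]
    by (simp add: block_decomposable m_def flip: scaleR_scaleR scaleR_sum_right)
       (simp add: linear_sum[OF matrix_vector_mul_linear] matrix_vector_mult_scaleR scaleR_sum_right)
  have bl: "bounded_bilinear ?b" by (rule bounded_bilinear_matrix_form)
  have int_b: "integrable \<Omega> (\<lambda>\<omega>. ?b (?g i + (\<Sum>j\<in>UNIV. c i j \<omega> *\<^sub>R ?h i j)) (?g i + (\<Sum>j\<in>UNIV. c i j \<omega> *\<^sub>R ?h i j)))" for i
    by (rule expectation_bilinear_random_sum(1)[OF bl int int2 mean cov])
  have "(\<integral>\<omega>. block_form Q (decomposable (laplacian (active E \<alpha> k \<omega>)) Md Mc *v x) \<partial>\<Omega>)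
      = (\<Sum>i\<in>UNIV. expectation (\<lambda>\<omega>. ?b (?g i + (\<Sum>j\<in>UNIV. c i j \<omega> *\<^sub>R ?h i j)) (?g i + (\<Sum>j\<in>UNIV. c i j \<omega> *\<^sub>R ?h i j))))"
    unfolding block_form_def step using int_b by (rule Bochner_Integration.integral_sum)
  also have "\<dots> = (\<Sum>i\<in>UNIV. ?b (?g i + (\<Sum>j\<in>UNIV. m i j *\<^sub>R ?h i j)) (?g i + (\<Sum>j\<in>UNIV. m i j *\<^sub>R ?h i j))
      + (\<Sum>j\<in>UNIV. v i j * ?b (?h i j) (?h i j)))"
    by (intro sum.cong refl expectation_bilinear_random_sum(2)[OF bl int int2 mean cov])
  also have "\<dots> = expected_block_form E p Md Mc Q x"
    unfolding expected_block_form_def block_form_def mean_step sum.distrib sum_distrib_left v_def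
    by (simp only: mult.assoc)
  finally show ?thesis .
qed

subsection \<open>Products of independent random matrices\<close>

text \<open>The autonomous state recursion over an abstract index sequence \<open>D\<close>. Below,
  \<open>'d\<close> is finite and stands for sets of edges, so at each time only finitely many
  states occur and integrability is automatic.\<close>

primrec random_product :: "('d \<Rightarrow> real^'n^'n) \<Rightarrow> (nat \<Rightarrow> 'd) \<Rightarrow> real^'n \<Rightarrow> nat \<Rightarrow> real^'n" where
  "random_product A D x 0 = x"
| "random_product A D x (Suc k) = A (D k) *v random_product A D x k"

lemma random_product_cong:
  "(\<And>i. i < k \<Longrightarrow> D i = D' i) \<Longrightarrow> random_product A D x k = random_product A D' x k"
  by (induction k) auto

lemma finite_range_random_product:
  fixes A :: "'d::finite \<Rightarrow> real^'n^'n"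
  shows "finite (range (\<lambda>D. random_product A D x k))"
proof (induction k)
  case (Suc k)
  have "range (\<lambda>D. random_product A D x (Suc k))
      \<subseteq> (\<Union>d. (*v) (A d) ` range (\<lambda>D. random_product A D x k))" by auto
  then show ?case by (rule finite_subset) (use Suc in simp)
qed simp

lemma measurable_finite_index:
  fixes g :: "'a \<Rightarrow> 'd::finite"
  assumes "\<And>d. f d \<in> measurable M N" "g \<in> measurable M (count_space UNIV)"
  shows "(\<lambda>x. f (g x) x) \<in> measurable M N"
  by (rule measurable_compose_countable'[OF assms]) (simp add: countable_finite)

lemma measurable_matrix_vector_mult:
  fixes M :: "real^'n^'m"
  shows "f \<in> borel_measurable N \<Longrightarrow> (\<lambda>x. M *v f x) \<in> borel_measurable N"
  by (rule borel_measurable_continuous_on[where f="(*v) M"])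
     (simp_all add: linear_continuous_on matrix_vector_mul_bounded_linear)

lemma measurable_random_product:
  fixes A :: "'d::finite \<Rightarrow> real^'n^'n"
  assumes "\<And>i. i < k \<Longrightarrow> (\<lambda>\<eta>. D \<eta> i) \<in> measurable M (count_space UNIV)"
  shows "(\<lambda>\<eta>. random_product A (D \<eta>) x k) \<in> borel_measurable M"
  using assms
proof (induction k)
  case (Suc k)
  have "(\<lambda>\<eta>. A (D \<eta> k) *v random_product A (D \<eta>) x k) \<in> borel_measurable M"
    using Suc by (intro measurable_finite_index[where g="\<lambda>\<eta>. D \<eta> k" and f="\<lambda>d \<eta>. A d *v random_product A (D \<eta>) x k"]
        measurable_matrix_vector_mult) auto
  then show ?case by simp
qed simp

lemma (in finite_measure) integrable_finite_range:
  fixes f :: "'a \<Rightarrow> 'b::{banach, second_countable_topology}"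
  assumes "finite S" "range f \<subseteq> S" "f \<in> borel_measurable M"
  shows "integrable M f"
proof (rule integrable_const_bound)
  show "AE x in M. norm (f x) \<le> Max (norm ` S)"
    using assms(1,2) by (intro AE_I2 Max_ge) auto
qed fact

lemma (in finite_measure) integrable_random_product:
  fixes A :: "'d::finite \<Rightarrow> real^'n^'n" and V :: "real^'n \<Rightarrow> real"
  assumes D: "\<And>i. i < k \<Longrightarrow> (\<lambda>\<eta>. D \<eta> i) \<in> measurable M (count_space UNIV)"
    and V: "continuous_on UNIV V"
  shows "integrable M (\<lambda>\<eta>. V (random_product A (D \<eta>) x k))"
proof (rule integrable_finite_range)
  show "finite (V ` range (\<lambda>D. random_product A D x k))"
    by (intro finite_imageI finite_range_random_product)
  show "(\<lambda>\<eta>. V (random_product A (D \<eta>) x k)) \<in> borel_measurable M"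
    by (rule borel_measurable_continuous_on[OF V measurable_random_product[OF D]])
qed auto

text \<open>The state at time \<open>k\<close> depends only on the modes before \<open>k\<close>, so it is independent of \<open>D k\<close>.\<close>

lemma (in prob_space) expectation_random_product_step:
  fixes A :: "'d::finite \<Rightarrow> real^'n^'n" and V :: "real^'n \<Rightarrow> real" and d0 :: 'd
  assumes indep: "indep_vars (\<lambda>_. count_space UNIV) D UNIV"
    and V: "continuous_on UNIV V"
    and contr: "\<And>x. expectation (\<lambda>\<omega>. V (A (D k \<omega>) *v x)) \<le> \<rho> * V x"
    and "k > 0"
  defines "D' \<equiv> (\<lambda>\<omega>. (\<lambda>i. D i \<omega>)(0 := d0))"
  shows "expectation (\<lambda>\<omega>. V (random_product A (D' \<omega>) x (Suc k)))
    \<le> \<rho> * expectation (\<lambda>\<omega>. V (random_product A (D' \<omega>) x k))"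
proof -
  let ?Y = "\<lambda>\<omega>. random_product A (D' \<omega>) x k"
  have D: "D i \<in> measurable M (count_space UNIV)" for i
    using indep by (auto simp: indep_vars_def)
  have D': "(\<lambda>\<omega>. D' \<omega> i) \<in> measurable M (count_space UNIV)" for i
    using D by (cases "i = 0") (simp_all add: D'_def)
  have Y: "?Y \<in> borel_measurable M" by (rule measurable_random_product) (rule D')
  \<comment> \<open>Indicators of the values of \<open>D k\<close> turn the random matrix
    \<open>A (D k \<omega>)\<close> into a finite sum over fixed matrices
    \<open>A d\<close>.\<close>
  define J where "J = (\<lambda>d \<omega>. of_bool (D k \<omega> = d) :: real)"
  have J: "integrable M (J d)" for d
  proof (rule integrable_finite_range[of "{0, 1}"])
    show "J d \<in> borel_measurable M"
      unfolding J_def by (rule measurable_compose[OF D]) simp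
  qed (auto simp: J_def)
  have VA: "continuous_on UNIV (\<lambda>y. V (A d *v y))" for d
    by (intro continuous_on_compose2[OF V] continuous_on_matrix_vector_mult) auto
  have W: "integrable M (\<lambda>\<omega>. V (A d *v ?Y \<omega>))" for d
    using integrable_random_product[OF D' VA] .
  have split: "V (A (D k \<omega>) *v y) = (\<Sum>d\<in>UNIV. J d \<omega> * V (A d *v y))" for \<omega> y
    by (simp add: J_def of_bool_def if_distrib[of "\<lambda>a. a * _"] cong: if_cong)
  have ind: "indep_var borel (J d) borel (\<lambda>\<omega>. V (A d *v ?Y \<omega>))" for d
  proof -
    let ?C = "\<lambda>I. PiM I (\<lambda>_. count_space UNIV :: 'd measure)"
    let ?f = "\<lambda>\<delta>. of_bool (\<delta> k = d) :: real"
    \<comment> \<open>The overwriting of index 0 is done inside this function, so independence of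
      the original \<open>D\<close> can be used directly.\<close>
    let ?g = "\<lambda>\<delta>. V (A d *v random_product A (\<delta>(0 := d0)) x k)"
    have "indep_var (?C {k}) (\<lambda>\<omega>. restrict (\<lambda>i. D i \<omega>) {k}) (?C {..<k}) (\<lambda>\<omega>. restrict (\<lambda>i. D i \<omega>) {..<k})"
      by (rule indep_var_restrict[OF indep]) auto
    then have "indep_var borel (?f \<circ> (\<lambda>\<omega>. restrict (\<lambda>i. D i \<omega>) {k}))
        borel (?g \<circ> (\<lambda>\<omega>. restrict (\<lambda>i. D i \<omega>) {..<k}))"
    proof (rule indep_var_compose)
      have "(\<lambda>\<delta>. \<delta> k) \<in> measurable (?C {k}) (count_space UNIV)"
        by (rule measurable_component_singleton) simp
      then show "?f \<in> borel_measurable (?C {k})"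
        by (rule measurable_compose) simp
      have "(\<lambda>\<delta>. (\<delta>(0 := d0)) i) \<in> measurable (?C {..<k}) (count_space UNIV)" if "i < k" for i
        using that measurable_component_singleton[of i "{..<k}" "\<lambda>_. count_space UNIV"]
        by (cases "i = 0") auto
      then show "?g \<in> borel_measurable (?C {..<k})"
        by (intro borel_measurable_continuous_on[OF VA] measurable_random_product)
    qed
    moreover have "random_product A ((restrict (\<lambda>i. D i \<omega>) {..<k})(0 := d0)) x k = ?Y \<omega>" for \<omega>
      by (rule random_product_cong) (auto simp: D'_def)
    ultimately show ?thesis by (simp add: comp_def J_def)
  qed
  \<comment> \<open>Since \<open>k > 0\<close>, the overwriting does not touch index
    \<open>k\<close>, and \<open>D' \<omega> k = D k \<omega>\<close>.\<close>
  have "expectation (\<lambda>\<omega>. V (random_product A (D' \<omega>) x (Suc k)))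
      = expectation (\<lambda>\<omega>. \<Sum>d\<in>UNIV. J d \<omega> * V (A d *v ?Y \<omega>))"
    using \<open>k > 0\<close> by (simp add: D'_def split)
  also have "\<dots> = (\<Sum>d\<in>UNIV. expectation (\<lambda>\<omega>. J d \<omega> * V (A d *v ?Y \<omega>)))"
    by (rule Bochner_Integration.integral_sum) (rule indep_var_integrable[OF ind J W])
  also have "\<dots> = (\<Sum>d\<in>UNIV. expectation (J d) * expectation (\<lambda>\<omega>. V (A d *v ?Y \<omega>)))"
    by (intro sum.cong refl indep_var_lebesgue_integral[OF ind J W])
  also have "\<dots> = expectation (\<lambda>\<omega>. \<Sum>d\<in>UNIV. expectation (J d) * V (A d *v ?Y \<omega>))"
    using W by (subst Bochner_Integration.integral_sum) auto
  also have "\<dots> \<le> expectation (\<lambda>\<omega>. \<rho> * V (?Y \<omega>))"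
  proof (rule integral_mono)
    \<comment> \<open>For a fixed \<open>y\<close> the weighted sum is again a one-step expectation,
      so the contraction applies pointwise at \<open>y = ?Y \<omega>\<close>.\<close>
    have "(\<Sum>d\<in>UNIV. expectation (J d) * V (A d *v y)) = expectation (\<lambda>\<omega>. V (A (D k \<omega>) *v y))" for y
      unfolding split using J by (subst Bochner_Integration.integral_sum) auto
    then show "(\<Sum>d\<in>UNIV. expectation (J d) * V (A d *v ?Y \<omega>)) \<le> \<rho> * V (?Y \<omega>)" for \<omega>
      using contr by simp
  qed (use W integrable_random_product[OF D' V] in auto)
  finally show ?thesis by simp
qed

text \<open>The first step uses the prescribed \<open>d0\<close> and need not contract; hence the
  exponent at time \<open>Suc k\<close> is only \<open>k\<close>.\<close>

lemma (in prob_space) expectation_random_product_geometric: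
  fixes A :: "'d::finite \<Rightarrow> real^'n^'n" and V :: "real^'n \<Rightarrow> real"
  assumes indep: "indep_vars (\<lambda>_. count_space UNIV) D UNIV"
    and V: "continuous_on UNIV V"
    and contr: "\<And>k x. expectation (\<lambda>\<omega>. V (A (D k \<omega>) *v x)) \<le> \<rho> * V x"
    and "\<rho> \<ge> 0"
  shows "expectation (\<lambda>\<omega>. V (random_product A ((\<lambda>i. D i \<omega>)(0 := d0)) x (Suc k))) \<le> \<rho> ^ k * V (A d0 *v x)"
proof (induction k)
  case 0
  then show ?case by (simp add: prob_space)
next
  case (Suc k)
  have "expectation (\<lambda>\<omega>. V (random_product A ((\<lambda>i. D i \<omega>)(0 := d0)) x (Suc (Suc k))))
      \<le> \<rho> * expectation (\<lambda>\<omega>. V (random_product A ((\<lambda>i. D i \<omega>)(0 := d0)) x (Suc k)))"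
    using expectation_random_product_step[OF indep V contr, of "Suc k"] by blast
  also have "\<dots> \<le> \<rho> * (\<rho> ^ k * V (A d0 *v x))"
    by (intro mult_left_mono Suc.IH \<open>\<rho> \<ge> 0\<close>)
  finally show ?case by (simp only: power_Suc mult.assoc)
qed

text \<open>Nonnegativity of the variance bounds the first moment by the square root of the
  second.\<close>

lemma (in prob_space) expectation_norm_tendsto_0:
  fixes X :: "nat \<Rightarrow> 'a \<Rightarrow> 'b::real_normed_vector"
  assumes int: "\<And>k. integrable M (\<lambda>\<omega>. norm (X k \<omega>))" "\<And>k. integrable M (\<lambda>\<omega>. (norm (X k \<omega>))\<^sup>2)"
    and lim: "(\<lambda>k. expectation (\<lambda>\<omega>. (norm (X k \<omega>))\<^sup>2)) \<longlonglongrightarrow> 0"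
  shows "(\<lambda>k. expectation (\<lambda>\<omega>. norm (X k \<omega>))) \<longlonglongrightarrow> 0"
proof (rule tendsto_sandwich[of "\<lambda>_. 0"])
  show "(\<lambda>k. sqrt (expectation (\<lambda>\<omega>. (norm (X k \<omega>))\<^sup>2))) \<longlonglongrightarrow> 0"
    using tendsto_real_sqrt[OF lim] by simp
  show "\<forall>\<^sub>F k in sequentially. expectation (\<lambda>\<omega>. norm (X k \<omega>)) \<le> sqrt (expectation (\<lambda>\<omega>. (norm (X k \<omega>))\<^sup>2))"
  proof (intro always_eventually allI real_le_rsqrt)
    fix k show "(expectation (\<lambda>\<omega>. norm (X k \<omega>)))\<^sup>2 \<le> expectation (\<lambda>\<omega>. (norm (X k \<omega>))\<^sup>2)"
      using variance_positive[of "\<lambda>\<omega>. norm (X k \<omega>)"] variance_eq[OF int(1,2), of k] by simp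
  qed
qed (auto intro!: always_eventually)

subsection \<open>Mean-square stability\<close>

theorem theorem6:
  fixes E0 :: "('v::finite \<times> 'v) set"
    and p :: real
    and \<Omega> :: "'w measure"
    and \<alpha> :: "'v \<times> 'v \<Rightarrow> nat \<Rightarrow> 'w \<Rightarrow> bool"
    and Em :: "nat \<Rightarrow> ('v \<times> 'v) set"
    and G :: "('x::finite, 'u::finite, 'z::finite) agent"
    and lam :: "nat \<Rightarrow> real"
  assumes "irrefl E0" and "sym E0"
    and "p \<in> {0..1}"
    and "packet_loss_process \<Omega> E0 p \<alpha>"
    and "mode_encoding E0 Em"
    and "eigenvalues (laplacian E0) lam"
    and "\<exists>Q. pos_def Q \<and>
           (\<forall>i\<in>{1..CARD('v)}.
              neg_def (transpose (Ad G + (p * lam i) *\<^sub>R Ac G) ** Q ** (Ad G + (p * lam i) *\<^sub>R Ac G)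
                       - Q + (2 * p * (1 - p) * lam i) *\<^sub>R (transpose (Ac G) ** Q ** Ac G)))"
  shows "mean_square_stable G (\<lambda>i. laplacian (Em i)) (modes E0) \<Omega> (mode_process E0 Em \<alpha>)"
proof -
  obtain Q where Q: "pos_def Q" and neg: "\<And>i. i \<in> {1..CARD('v)} \<Longrightarrow>
      neg_def (transpose (Ad G + (p * lam i) *\<^sub>R Ac G) ** Q ** (Ad G + (p * lam i) *\<^sub>R Ac G)
        - Q + (2 * p * (1 - p) * lam i) *\<^sub>R (transpose (Ac G) ** Q ** Ac G))"
    using assms(7) by blast
  let ?V = "block_form Q :: real^('v \<times> 'x) \<Rightarrow> real"
  \<comment> \<open>The matrices are indexed by active edge sets rather than mode numbers, a finite
    type on which independence over time is assumed directly.\<close>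
  define A :: "('v \<times> 'v) set \<Rightarrow> real^('v \<times> 'x)^('v \<times> 'x)"
    where "A = (\<lambda>D. decomposable (laplacian D) (Ad G) (Ac G))"
  obtain \<rho> where \<rho>: "0 \<le> \<rho>" "\<rho> < 1"
    and contr: "\<And>x :: real^('v \<times> 'x). expected_block_form E0 p (Ad G) (Ac G) Q x \<le> \<rho> * ?V x"
    using expected_block_form_contraction[OF assms(1,2,6) Q neg] by metis
  obtain c where c: "0 \<le> c" "\<And>x. (norm x)\<^sup>2 \<le> c * ?V x"
    using norm_square_le_block_form[OF Q] by metis
  have V: "continuous_on UNIV ?V" by (rule continuous_on_block_form)
  interpret \<Omega>: prob_space \<Omega> using assms(4) by (simp add: packet_loss_process_def)
  let ?D = "active E0 \<alpha>"
  have indep: "\<Omega>.indep_vars (\<lambda>_. count_space UNIV) ?D UNIV"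
    using assms(4) by (simp add: packet_loss_process_def)
  then have D: "?D k \<in> measurable \<Omega> (count_space UNIV)" for k
    by (auto simp: \<Omega>.indep_vars_def)
  have step: "\<Omega>.expectation (\<lambda>\<omega>. ?V (A (?D k \<omega>) *v x)) \<le> \<rho> * ?V x" for k x
    using contr[of x] by (simp add: A_def expectation_block_form[OF assms(4,1)])
  have Em: "Em (mode_process E0 Em \<alpha> k \<omega>) = ?D k \<omega>" for k \<omega>
    unfolding mode_process_def using assms(5)
    by (intro f_the_inv_into_f_bij_betw) (auto simp: mode_encoding_def active_def)
  show ?thesis
    unfolding mean_square_stable_def Let_def
  proof (intro allI impI)
    fix x0 and \<sigma>0 :: "nat pmf"
    let ?P = "measure_pmf \<sigma>0 \<Otimes>\<^sub>M \<Omega>"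
    let ?x = "\<lambda>k \<eta>. state G (\<lambda>i. laplacian (Em i)) (with_initial_mode (mode_process E0 Em \<alpha>) \<eta>) (\<lambda>_. 0) x0 k"
    interpret P: pair_prob_space "measure_pmf \<sigma>0" \<Omega> ..
    \<comment> \<open>The path of active edge sets: the initial mode is decoded through
      \<open>Em\<close>, and all later sets come from the loss process.\<close>
    define \<delta> where "\<delta> = (\<lambda>\<eta>. (\<lambda>i. ?D i (snd \<eta>))(0 := Em (fst \<eta>)))"
    have x: "?x k \<eta> = random_product A (\<delta> \<eta>) x0 k" for k \<eta>
      by (induction k) (auto simp: A_def \<delta>_def with_initial_mode_def Em)
    have \<delta>: "(\<lambda>\<eta>. \<delta> \<eta> i) \<in> measurable ?P (count_space UNIV)" for i
    proof (cases "i = 0")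
      case True
      have "Em \<circ> fst \<in> measurable ?P (count_space UNIV)"
        by (rule measurable_comp[OF measurable_fst]) simp
      then show ?thesis using True by (simp add: \<delta>_def comp_def)
    next
      case False
      then show ?thesis
        using measurable_compose[OF measurable_snd D] by (simp add: \<delta>_def)
    qed
    have int: "integrable ?P (\<lambda>\<eta>. f (random_product A (\<delta> \<eta>) x0 k))"
      if "continuous_on UNIV f" for f :: "real^('v \<times> 'x) \<Rightarrow> real" and k
      by (rule P.integrable_random_product[OF \<delta> that])
    have int_norm: "integrable ?P (\<lambda>\<eta>. norm (random_product A (\<delta> \<eta>) x0 k))"
      "integrable ?P (\<lambda>\<eta>. (norm (random_product A (\<delta> \<eta>) x0 k))\<^sup>2)" for k
      by (intro int continuous_intros)+
    \<comment> \<open>The maximum over the finitely many edge sets bounds the Lyapunov function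
      after the first step, uniformly in the initial mode.\<close>
    define K where "K = Max (range (\<lambda>d. ?V (A d *v x0)))"
    have K: "?V (A d *v x0) \<le> K" for d unfolding K_def by (rule Max_ge) auto
    have V_bound: "(\<integral>\<eta>. ?V (random_product A (\<delta> \<eta>) x0 (Suc k)) \<partial>?P) \<le> \<rho> ^ k * K" for k
    proof -
      \<comment> \<open>Fubini fixes the initial mode \<open>m\<close> first; for each
        \<open>m\<close> the geometric bound holds with \<open>d0 = Em m\<close>.\<close>
      have "(\<integral>\<eta>. ?V (random_product A (\<delta> \<eta>) x0 (Suc k)) \<partial>?P)
          = (\<integral>m. (\<integral>\<omega>. ?V (random_product A (\<delta> (m, \<omega>)) x0 (Suc k)) \<partial>\<Omega>) \<partial>measure_pmf \<sigma>0)"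
        by (rule P.integral_fst'[OF int[OF V], symmetric])
      also have "\<dots> \<le> \<rho> ^ k * K"
      proof (rule measure_pmf.integral_le_const[OF P.integrable_fst'[OF int[OF V]]], intro AE_I2)
        fix m
        have "(\<integral>\<omega>. ?V (random_product A (\<delta> (m, \<omega>)) x0 (Suc k)) \<partial>\<Omega>) \<le> \<rho> ^ k * ?V (A (Em m) *v x0)"
          using \<Omega>.expectation_random_product_geometric[OF indep V step \<rho>(1), of "Em m" x0 k]
          by (simp add: \<delta>_def)
        also have "\<dots> \<le> \<rho> ^ k * K" using K \<rho>(1) by (intro mult_left_mono) auto
        finally show "(\<integral>\<omega>. ?V (random_product A (\<delta> (m, \<omega>)) x0 (Suc k)) \<partial>\<Omega>) \<le> \<rho> ^ k * K" .
      qed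
      finally show ?thesis .
    qed
    have sq: "(\<lambda>k. \<integral>\<eta>. (norm (random_product A (\<delta> \<eta>) x0 k))\<^sup>2 \<partial>?P) \<longlonglongrightarrow> 0"
    \<comment> \<open>The geometric bound starts at time 1, so the limit is taken along the shifted
      sequence.\<close>
    proof (rule LIMSEQ_imp_Suc, rule tendsto_sandwich[of "\<lambda>_. 0"])
      show "\<forall>\<^sub>F k in sequentially. (\<integral>\<eta>. (norm (random_product A (\<delta> \<eta>) x0 (Suc k)))\<^sup>2 \<partial>?P) \<le> c * (\<rho> ^ k * K)"
      proof (intro always_eventually allI)
        fix k
        have "(\<integral>\<eta>. (norm (random_product A (\<delta> \<eta>) x0 (Suc k)))\<^sup>2 \<partial>?P)
            \<le> (\<integral>\<eta>. c * ?V (random_product A (\<delta> \<eta>) x0 (Suc k)) \<partial>?P)"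
          by (rule integral_mono[OF int_norm(2) integrable_mult_right[OF int[OF V]] c(2)])
        also have "\<dots> = c * (\<integral>\<eta>. ?V (random_product A (\<delta> \<eta>) x0 (Suc k)) \<partial>?P)" by simp
        also have "\<dots> \<le> c * (\<rho> ^ k * K)" by (intro mult_left_mono V_bound c(1))
        finally show "(\<integral>\<eta>. (norm (random_product A (\<delta> \<eta>) x0 (Suc k)))\<^sup>2 \<partial>?P) \<le> c * (\<rho> ^ k * K)" .
      qed
      have "(\<lambda>k. \<rho> ^ k) \<longlonglongrightarrow> 0" using \<rho> by (intro LIMSEQ_power_zero) simp
      then show "(\<lambda>k. c * (\<rho> ^ k * K)) \<longlonglongrightarrow> 0"
        by (intro tendsto_mult_right_zero tendsto_mult_left_zero)
    qed (auto intro!: always_eventually)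
    have "(\<lambda>k. \<integral>\<eta>. norm (random_product A (\<delta> \<eta>) x0 k) \<partial>?P) \<longlonglongrightarrow> 0"
      by (rule P.expectation_norm_tendsto_0[OF int_norm sq])
    then show "(\<lambda>k. \<integral>\<eta>. norm (?x k \<eta>) \<partial>?P) \<longlonglongrightarrow> 0 \<and> (\<lambda>k. \<integral>\<eta>. norm (outer (?x k \<eta>)) \<partial>?P) \<longlonglongrightarrow> 0"
      using sq by (simp only: x norm_outer simp_thms)
  qed
qed

end
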